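(* For every $c>0$ there is a $c'>0$ such that the following holds. Let $G$ be a $C_4$-free $n$-vertex graph with $cn^{3/2}$ edges. Then $G$ contains a $TK_{\ell}$ with $\ell=\lfloor c'n^{1/2}\rfloor$ in which every edge of the $K_\ell$ is subdivided exactly $3$ times (that is, every edge of $K_\ell$ is replaced by a path of length exactly $4$, these paths being internally vertex-disjoint).
   Context: Graphs are finite and simple. $C_4$-free means containing no cycle of length $4$ as a (not necessarily induced) subgraph. A $TK_\ell$ (subdivision of the clique $K_\ell$) is a graph obtained from $K_\ell$ by replacing its edges by internally vertex-disjoint paths joining the same endpoints; for $\ell=0$ the containment is trivial. *)

theory Defs
  imports Complex_Main "Graph_Theory.Kuratowski"
begin

text \<open>
  A finite simple graph is a \<^locale>\<open>pair_graph\<close>: a finite, loop-free digraph whose arc relation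
  is symmetric.  An undirected edge \<open>{u, v}\<close> is thus represented by the two arcs \<open>(u, v)\<close>
  and \<open>(v, u)\<close>.
\<close>

definition uedges :: "'a pair_pre_digraph \<Rightarrow> 'a set set" where
  "uedges G = {{u, v} | u v. (u, v) \<in> parcs G}"

text \<open>
  The closed walk \<open>u, v, u\<close> counts as a cycle in the library, but cycles of length at least 3
  in the library are exactly the usual cycles of the underlying undirected graph.
\<close>

definition C4_free :: "'a pair_pre_digraph \<Rightarrow> bool" where
  "C4_free G \<longleftrightarrow> \<not> (\<exists>p. pre_digraph.cycle (with_proj G) p \<and> length p = 4)"

text \<open>
  \<open>H\<close> arises from \<open>K\<close> by subdividing every edge exactly \<open>k\<close> times: the edge \<open>{u, v}\<close> is
  replaced by the path \<open>P (u, v)\<close> of length \<open>k + 1\<close>, where \<open>P (v, u)\<close> is the same path traversed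
  backwards.  The condition \<open>gen_iapath (pverts K)\<close> says that \<open>P (u, v)\<close> is a path in \<open>H\<close> whose
  inner vertices are not vertices of \<open>K\<close>.
\<close>

definition exact_subdivision ::
    "nat \<Rightarrow> 'a pair_pre_digraph \<Rightarrow> 'a pair_pre_digraph \<Rightarrow> bool" where
  "exact_subdivision k K H \<longleftrightarrow>
     (\<exists>P :: 'a \<times> 'a \<Rightarrow> ('a \<times> 'a) awalk.
        (\<forall>(u, v) \<in> parcs K.
            pre_digraph.gen_iapath (with_proj H) (pverts K) u (P (u, v)) v
          \<and> length (P (u, v)) = k + 1
          \<and> P (v, u) = rev_path (P (u, v)))
      \<and> (\<forall>(u, v) \<in> parcs K. \<forall>(x, y) \<in> parcs K. {u, v} \<noteq> {x, y} \<longrightarrow>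
            set (pre_digraph.inner_verts (with_proj H) (P (u, v)))
          \<inter> set (pre_digraph.inner_verts (with_proj H) (P (x, y))) = {})
      \<and> pverts H = pverts K
          \<union> (\<Union>e \<in> parcs K. set (pre_digraph.inner_verts (with_proj H) (P e)))
      \<and> parcs H = (\<Union>e \<in> parcs K. set (P e)))"

definition contains_exact_TK :: "nat \<Rightarrow> nat \<Rightarrow> 'a pair_pre_digraph \<Rightarrow> bool" where
  "contains_exact_TK k l G \<longleftrightarrow>
     (\<exists>K H :: 'a pair_pre_digraph.
        complete_digraph l (with_proj K) \<and> exact_subdivision k K H
        \<and> subgraph (with_proj H) (with_proj G))"

end

theory Submission
  imports Defs "HOL-Library.FuncSet"
begin

text \<open>
  Let \<open>G\<close> be \<open>C\<^sub>4\<close>-free with \<open>n\<close> vertices and at least \<open>c n\<^bsup>3/2\<^esup>\<close> edges.  Two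
  vertices have at most one common neighbour, so the sum of \<open>d(v) (d(v) - 1)\<close> over all
  vertices is at most \<open>n\<^sup>2\<close>, and few edges meet vertices of degree much larger than
  \<open>n\<^bsup>1/2\<^esup>\<close>.  Without them, a maximality argument and a balanced cut give a nonempty bipartite
  subgraph in which all degrees are of the order of \<open>n\<^bsup>1/2\<^esup>\<close>
  (\<open>few_arcs_at_high_degree\<close>, \<open>bipartite_min_degree_subgraph\<close>).

  Fix any vertex \<open>x\<close> of this subgraph and take all branch vertices from its neighbourhood.
  Two of them, \<open>u\<close> and \<open>v\<close>, have only \<open>x\<close> as a common neighbour.  Hence a path
  \<open>u, a, w, b, v\<close> avoiding \<open>x\<close> is determined by its middle vertex \<open>w\<close>; the vertices
  \<open>a\<close> available to different branch vertices are different; and by bipartiteness the vertices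
  \<open>a, b\<close> are never confused with middle or branch vertices.  What remains is to give distinct
  middle vertices to the pairs of branch vertices in such a way that the paths starting at the same
  branch vertex leave it through different neighbours.

  Every branch vertex reaches a constant proportion of all vertices in two steps, but a particular
  pair may have only few common middle vertices, say \<open>k\<close>.  It is not required that all
  pairs have linearly many.  One takes as branch vertices those neighbours of \<open>x\<close> that
  reach two random vertices: then pairs with small \<open>k\<close> are so rare that, after passing to a
  constant fraction of the branch vertices, the sum of \<open>1 / k\<close> over the partners of each branch
  vertex \<open>u\<close> is at most \<open>\<epsilon> n\<^bsup>-1/2\<^esup>\<close>, with \<open>\<epsilon>\<close> as small as desired
  (\<open>two_point_common_nbhd\<close>, \<open>small_row_subset\<close>).  So \<open>u\<close> has at most
  \<open>\<epsilon> k n\<^bsup>-1/2\<^esup>\<close> partners with at most \<open>k\<close> common middle vertices.  Let the pairs choose in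
  the order of increasing \<open>k\<close>.  When a pair with \<open>k\<close> candidates is due, each of the
  \<open>O(\<epsilon> k n\<^bsup>-1/2\<^esup>)\<close> earlier pairs meeting it blocks \<open>O(n\<^bsup>1/2\<^esup>)\<close> candidates, and each of the
  \<open>O(\<epsilon> k)\<close> other earlier pairs blocks one, so that a free candidate is left
  (\<open>linkage_of_small_rows\<close>).
\<close>

section \<open>Symmetric weights and balanced partitions\<close>

text \<open>
  Every pair of distinct points of \<open>V\<close> is counted in both orders; with the indicator
  of an adjacency relation as weight, this is the number of arcs inside \<open>V\<close>.
\<close>
definition energy :: "('a \<Rightarrow> 'a \<Rightarrow> real) \<Rightarrow> 'a set \<Rightarrow> real" where
  "energy w V = (\<Sum>v\<in>V. \<Sum>u\<in>V - {v}. w v u)"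

lemma energy_insert:
  assumes "finite V" "v \<notin> V" and sym: "\<And>u v. w u v = w v u"
  shows "energy w (insert v V) = energy w V + 2 * (\<Sum>u\<in>V. w v u)"
proof -
  have "(\<Sum>x\<in>V. \<Sum>u\<in>insert v V - {x}. w x u) = (\<Sum>x\<in>V. w x v + (\<Sum>u\<in>V - {x}. w x u))"
  proof (rule sum.cong[OF refl])
    fix x assume "x \<in> V"
    then have "insert v V - {x} = insert v (V - {x})" using assms(2) by auto
    then show "(\<Sum>u\<in>insert v V - {x}. w x u) = w x v + (\<Sum>u\<in>V - {x}. w x u)"
      using assms(1,2) by simp
  qed
  moreover have "(\<Sum>x\<in>V. w x v) = (\<Sum>u\<in>V. w v u)" by (intro sum.cong refl sym)
  moreover have "insert v V - {v} = V" using assms(2) by auto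
  ultimately show ?thesis
    using assms(1,2) unfolding energy_def by (simp add: sum.distrib)
qed

text \<open>
  The subset that maximises \<open>energy w V - t * card V\<close> does not gain from dropping a
  point, and dropping \<open>v\<close> changes the energy by twice the row sum of \<open>v\<close>.  For
  \<open>t > 0\<close> this finds subgraphs of large minimum degree; applied to negated weights and
  negative \<open>t\<close> it discards the points with large row sums.
\<close>
lemma energy_core:
  fixes w :: "'a \<Rightarrow> 'a \<Rightarrow> real" and t :: real
  assumes "finite U" and sym: "\<And>u v. w u v = w v u"
  obtains V where "V \<subseteq> U" "energy w U - t * card U \<le> energy w V - t * card V"
    "\<And>v. v \<in> V \<Longrightarrow> t \<le> 2 * (\<Sum>u\<in>V - {v}. w v u)"
proof -
  define P where "P V = energy w V - t * card V" for V
  have fin: "finite (P ` Pow U)" "P ` Pow U \<noteq> {}" using assms by auto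
  obtain V where V: "V \<in> Pow U" "P V = Max (P ` Pow U)"
    using Max_in[OF fin] by force
  have max: "P V' \<le> P V" if "V' \<subseteq> U" for V'
    using that V fin by simp
  show ?thesis
  proof
    show "V \<subseteq> U" using V by simp
    show "energy w U - t * card U \<le> energy w V - t * card V"
      using max[of U] by (simp add: P_def)
    fix v assume v: "v \<in> V"
    have fV: "finite V" using V assms finite_subset by auto
    have "energy w V = energy w (V - {v}) + 2 * (\<Sum>u\<in>V - {v}. w v u)"
      using energy_insert[of "V - {v}" v w] fV v sym by (simp add: insert_absorb)
    moreover have "real (card V) = card (V - {v}) + 1"
      using card_Suc_Diff1[OF fV v] by linarith
    moreover have "P (V - {v}) \<le> P V" using V by (intro max) auto
    ultimately show "t \<le> 2 * (\<Sum>u\<in>V - {v}. w v u)"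
      by (simp add: P_def algebra_simps)
  qed
qed

text \<open>
  A partition minimising the energy inside its classes is a local optimum: moving \<open>v\<close> to
  another class does not help, so among the \<open>r\<close> classes its own one carries the least
  weight of its row, hence at most the average.  This replaces random sampling.
\<close>
lemma balanced_partition:
  fixes w :: "'a \<Rightarrow> 'a \<Rightarrow> real" and r :: nat
  assumes "finite V" "r > 0" and sym: "\<And>u v. w u v = w v u"
  obtains f :: "'a \<Rightarrow> nat" where "\<And>v. v \<in> V \<Longrightarrow> f v < r"
    "\<And>v. v \<in> V \<Longrightarrow> r * (\<Sum>u | u \<in> V - {v} \<and> f u = f v. w v u) \<le> (\<Sum>u\<in>V - {v}. w v u)"
proof -
  define F where "F = V \<rightarrow>\<^sub>E {..<r}"
  define W where "W f u v = (if f u = f v then w u v else 0)" for f :: "'a \<Rightarrow> nat" and u v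
  have "finite F" unfolding F_def using assms by (intro finite_PiE) auto
  moreover have "F \<noteq> {}" using \<open>r > 0\<close> unfolding F_def by (simp add: PiE_eq_empty_iff lessThan_empty_iff)
  ultimately have fin: "finite ((\<lambda>f. energy (W f) V) ` F)" "(\<lambda>f. energy (W f) V) ` F \<noteq> {}" by auto
  obtain f where f: "f \<in> F" "energy (W f) V = Min ((\<lambda>f. energy (W f) V) ` F)"
    using Min_in[OF fin] by force
  have min: "energy (W f) V \<le> energy (W g) V" if "g \<in> F" for g
    using f(2) fin that by simp
  show ?thesis
  proof
    show "f v < r" if "v \<in> V" for v using that f(1) by (auto simp: F_def)
    fix v assume v: "v \<in> V"
    define row where "row j = (\<Sum>u | u \<in> V - {v} \<and> f u = j. w v u)" for j
    \<comment> \<open>Only the row of \<open>v\<close> depends on the class \<open>j\<close> of \<open>v\<close>.\<close>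
    have split: "energy (W (f(v := j))) V = energy (W f) (V - {v}) + 2 * row j" for j
    proof -
      let ?g = "f(v := j)"
      have "energy (W ?g) V = energy (W ?g) (V - {v}) + 2 * (\<Sum>u\<in>V - {v}. W ?g v u)"
        using energy_insert[of "V - {v}" v "W ?g"] assms v by (simp add: insert_absorb W_def)
      moreover have "energy (W ?g) (V - {v}) = energy (W f) (V - {v})"
        unfolding energy_def by (intro sum.cong refl) (auto simp: W_def)
      moreover have "(\<Sum>u\<in>V - {v}. W ?g v u) = (\<Sum>u\<in>V - {v}. if f u = j then w v u else 0)"
        by (intro sum.cong refl) (auto simp: W_def)
      moreover have "\<dots> = row j"
        unfolding row_def using \<open>finite V\<close> by (intro sum.inter_filter[symmetric]) auto
      ultimately show ?thesis by simp
    qed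
    have "row (f v) \<le> row j" if "j < r" for j
    proof -
      have "f(v := j) \<in> F" using f(1) v that by (auto simp: F_def PiE_def extensional_def)
      from min[OF this] split[of j] split[of "f v"] show ?thesis by simp
    qed
    then have "(\<Sum>j<r. row (f v)) \<le> (\<Sum>j<r. row j)" by (intro sum_mono) auto
    also have "(\<Sum>j<r. row j) = (\<Sum>u\<in>V - {v}. w v u)"
      unfolding row_def using \<open>finite V\<close> f(1) by (intro sum.group) (auto simp: F_def)
    finally show "r * (\<Sum>u | u \<in> V - {v} \<and> f u = f v. w v u) \<le> (\<Sum>u\<in>V - {v}. w v u)"
      by (simp add: row_def)
  qed
qed

section \<open>Greedy choice\<close>

text \<open>
  Choose in the order of increasing \<open>rank\<close>.  Each item \<open>j\<close> treated before \<open>i\<close>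
  blocks at most \<open>b i j\<close> candidates of \<open>i\<close>, whatever was chosen for it, and these
  losses together do not exhaust \<open>C i\<close>.
\<close>
lemma greedy_choice:
  fixes rank :: "'i \<Rightarrow> nat" and C :: "'i \<Rightarrow> 'c set"
  assumes "finite I"
    and fin: "\<And>i. i \<in> I \<Longrightarrow> finite (C i)"
    and sym: "\<And>i c j d. conf i c j d \<Longrightarrow> conf j d i c"
    and bad: "\<And>i j d. i \<in> I \<Longrightarrow> j \<in> I \<Longrightarrow> i \<noteq> j \<Longrightarrow> card {c \<in> C i. conf i c j d} \<le> b i j"
    and room: "\<And>i. i \<in> I \<Longrightarrow> (\<Sum>j | j \<in> I \<and> j \<noteq> i \<and> rank j \<le> rank i. b i j) < card (C i)"
  shows "\<exists>f. (\<forall>i\<in>I. f i \<in> C i) \<and> (\<forall>i\<in>I. \<forall>j\<in>I. i \<noteq> j \<longrightarrow> \<not> conf i (f i) j (f j))"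
  using assms(1,2,4,5)
proof (induction "card I" arbitrary: I)
  case 0
  then have "I = {}" by simp
  then show ?case by simp
next
  case (Suc n)
  from Suc.hyps(2) have "I \<noteq> {}" by force
  \<comment> \<open>The induction removes an item of largest rank, which is chosen last.\<close>
  have "\<exists>i\<in>I. \<forall>j\<in>I. rank j \<le> rank i"
  proof -
    have "Max (rank ` I) \<in> rank ` I" using \<open>I \<noteq> {}\<close> Suc.prems(1) by simp
    then obtain i where "i \<in> I" "rank i = Max (rank ` I)" by force
    then show ?thesis using Suc.prems(1) by (intro bexI[of _ i]) simp_all
  qed
  then obtain i where i: "i \<in> I" "\<And>j. j \<in> I \<Longrightarrow> rank j \<le> rank i" by blast
  have "\<exists>f. (\<forall>k\<in>I - {i}. f k \<in> C k) \<and>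
      (\<forall>k\<in>I - {i}. \<forall>j\<in>I - {i}. k \<noteq> j \<longrightarrow> \<not> conf k (f k) j (f j))"
  proof (rule Suc.hyps(1))
    show "n = card (I - {i})" using Suc i by simp
    fix k assume k: "k \<in> I - {i}"
    have "(\<Sum>j | j \<in> I - {i} \<and> j \<noteq> k \<and> rank j \<le> rank k. b k j)
        \<le> (\<Sum>j | j \<in> I \<and> j \<noteq> k \<and> rank j \<le> rank k. b k j)"
      using Suc.prems(1) by (intro sum_mono2) auto
    also have "\<dots> < card (C k)" using Suc.prems(4) k by simp
    finally show "(\<Sum>j | j \<in> I - {i} \<and> j \<noteq> k \<and> rank j \<le> rank k. b k j) < card (C k)" .
  next
    show "finite (I - {i})" using Suc.prems(1) by simp
    show "finite (C k)" if "k \<in> I - {i}" for k using Suc.prems(2) that by simp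
    show "card {c \<in> C k. conf k c j d} \<le> b k j"
      if "k \<in> I - {i}" "j \<in> I - {i}" "k \<noteq> j" for k j d
      using Suc.prems(3) that by simp
  qed
  then obtain f where f: "\<And>k. k \<in> I - {i} \<Longrightarrow> f k \<in> C k"
    "\<And>k j. k \<in> I - {i} \<Longrightarrow> j \<in> I - {i} \<Longrightarrow> k \<noteq> j \<Longrightarrow> \<not> conf k (f k) j (f j)" by blast
  define B where "B = (\<Union>j\<in>I - {i}. {c \<in> C i. conf i c j (f j)})"
  have "card B \<le> (\<Sum>j\<in>I - {i}. card {c \<in> C i. conf i c j (f j)})"
    unfolding B_def using Suc.prems(1) by (intro card_UN_le) auto
  also have "\<dots> \<le> (\<Sum>j\<in>I - {i}. b i j)"
    using i(1) by (intro sum_mono Suc.prems(3)) auto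
  also have "I - {i} = {j. j \<in> I \<and> j \<noteq> i \<and> rank j \<le> rank i}"
    using i(2) by blast
  also have "(\<Sum>j | j \<in> I \<and> j \<noteq> i \<and> rank j \<le> rank i. b i j) < card (C i)"
    using Suc.prems(4) i by simp
  finally have "card B < card (C i)" .
  moreover have "finite B"
    using Suc.prems(2)[OF i(1)] by (rule rev_finite_subset) (simp add: B_def UN_least)
  ultimately have "\<not> C i \<subseteq> B" using card_mono[of B "C i"] by linarith
  then obtain c where c: "c \<in> C i" "c \<notin> B" by blast
  have 1: "\<not> conf i c j (f j)" if "j \<in> I" "j \<noteq> i" for j
    using c that by (simp add: B_def)
  then have 2: "\<not> conf j (f j) i c" if "j \<in> I" "j \<noteq> i" for j
    using that sym[of j "f j" i c] by blast
  define g where "g k = (if k = i then c else f k)" for k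
  have "g k \<in> C k" if "k \<in> I" for k
    using that c(1) f(1)[of k] by (cases "k = i") (simp_all add: g_def)
  moreover have "\<not> conf k (g k) j (g j)" if "k \<in> I" "j \<in> I" "k \<noteq> j" for k j
    using that 1[of j] 2[of k] f(2)[of k j] by (cases "k = i"; cases "j = i") (simp_all add: g_def)
  ultimately show ?case by blast
qed

section \<open>Dependent random choice\<close>

lemma sum_card_filter_swap:
  assumes "finite A" "finite B"
  shows "(\<Sum>a\<in>A. card {b \<in> B. P a b}) = (\<Sum>b\<in>B. card {a \<in> A. P a b})"
proof -
  have "(\<Sum>a\<in>A. card {b \<in> B. P a b}) = (\<Sum>a\<in>A. \<Sum>b\<in>B. if P a b then 1 else 0)"
    using assms by (simp add: sum.If_cases Int_def)
  also have "\<dots> = (\<Sum>b\<in>B. \<Sum>a\<in>A. if P a b then 1 else 0)" by (rule sum.swap)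
  also have "\<dots> = (\<Sum>b\<in>B. card {a \<in> A. P a b})"
    using assms by (simp add: sum.If_cases Int_def)
  finally show ?thesis .
qed

text \<open>
  Dependent random choice with two points: \<open>U\<close> is the set of all \<open>u\<close> whose set
  \<open>N u\<close> contains both of two points chosen at random from \<open>Z\<close>.  A pair \<open>u, v\<close>
  with \<open>k\<close> common points lands in \<open>U\<close> with probability \<open>(k / |Z|)\<^sup>2\<close>, so its expected
  contribution to the sum of \<open>1 / k\<close> is at most \<open>1 / |Z|\<close>: pairs with few common points
  are not excluded, but they are rare in proportion to how few points they share.
\<close>
lemma two_point_common_nbhd:
  fixes N :: "'a \<Rightarrow> 'z set" and \<rho> :: real
  assumes fin: "finite U0" "finite Z" and "U0 \<noteq> {}" "\<rho> > 0"
    and N: "\<And>u. u \<in> U0 \<Longrightarrow> N u \<subseteq> Z" "\<And>u. u \<in> U0 \<Longrightarrow> \<rho> \<le> card (N u)"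
  obtains U where "U \<subseteq> U0" "\<rho>\<^sup>2 * card U0 \<le> 2 * (card Z)\<^sup>2 * card U"
    "\<And>u v. u \<in> U \<Longrightarrow> v \<in> U \<Longrightarrow> N u \<inter> N v \<noteq> {}"
    "\<rho>\<^sup>2 * energy (\<lambda>u v. 1 / card (N u \<inter> N v)) U \<le> 2 * card U0 * card Z * card U"
proof -
  define T where "T z = {u \<in> U0. fst z \<in> N u \<and> snd z \<in> N u}" for z :: "'z \<times> 'z"
  define g where "g u v = 1 / real (card (N u \<inter> N v))" for u v
  \<comment> \<open>The mean of \<open>h\<close> over all pairs \<open>z\<close> is large.  As \<open>h z\<close> is a
    difference of nonnegative terms, a single large value of it gives both that
    \<open>T z\<close> is large and that its energy is small compared with its size.\<close>
  define h where "h z = 2 * card U0 * card Z * card (T z) - \<rho>\<^sup>2 * energy g (T z)" for z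
  have finN: "finite (N u)" if "u \<in> U0" for u
    using N(1)[OF that] fin(2) by (rule finite_subset)
  have finT: "finite (T z)" for z using fin(1) by (simp add: T_def)
  have "Z \<noteq> {}"
  proof -
    obtain u where u: "u \<in> U0" using \<open>U0 \<noteq> {}\<close> by blast
    have "N u \<noteq> {}" using N(2)[OF u] \<open>\<rho> > 0\<close> by auto
    then show ?thesis using N(1)[OF u] by blast
  qed
  have pos: "card U0 > 0" "card Z > 0" using fin \<open>U0 \<noteq> {}\<close> \<open>Z \<noteq> {}\<close> by (auto simp: card_gt_0_iff)
  have sq: "card {z \<in> Z \<times> Z. fst z \<in> M \<and> snd z \<in> M} = (card M)\<^sup>2" if "M \<subseteq> Z" for M
  proof -
    have "{z \<in> Z \<times> Z. fst z \<in> M \<and> snd z \<in> M} = M \<times> M" using that by auto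
    then show ?thesis by (simp add: card_cartesian_product power2_eq_square)
  qed
  have "(\<Sum>z\<in>Z \<times> Z. card (T z)) = (\<Sum>u\<in>U0. (card (N u))\<^sup>2)"
    unfolding T_def using fin sq[OF N(1)]
    by (subst sum_card_filter_swap) (auto intro!: sum.cong)
  then have "(\<Sum>z\<in>Z \<times> Z. real (card (T z))) = (\<Sum>u\<in>U0. (real (card (N u)))\<^sup>2)"
    by (metis (mono_tags, lifting) of_nat_power of_nat_sum sum.cong)
  moreover have "(\<Sum>u\<in>U0. (real (card (N u)))\<^sup>2) \<ge> (\<Sum>u\<in>U0. \<rho>\<^sup>2)"
    using N(2) \<open>\<rho> > 0\<close> by (intro sum_mono power_mono) auto
  ultimately have size: "(\<Sum>z\<in>Z \<times> Z. real (card (T z))) \<ge> card U0 * \<rho>\<^sup>2" by simp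
  have "(\<Sum>z\<in>Z \<times> Z. energy g (T z)) \<le> (card U0)\<^sup>2 * card Z"
  proof -
    have "energy g (T z) \<le> (\<Sum>v\<in>U0. \<Sum>u\<in>U0. if u \<in> T z \<and> v \<in> T z then g v u else 0)" for z
    proof -
      have g0: "g v u \<ge> 0" for u v by (simp add: g_def)
      have "energy g (T z) \<le> (\<Sum>v\<in>T z. \<Sum>u\<in>T z. g v u)"
        unfolding energy_def using finT g0 by (intro sum_mono sum_mono2) auto
      also have "\<dots> = (\<Sum>v\<in>T z. \<Sum>u\<in>U0. if u \<in> T z \<and> v \<in> T z then g v u else 0)"
        by (rule sum.cong[OF refl], rule sum.mono_neutral_cong_left) (auto simp: T_def fin)
      also have "\<dots> \<le> (\<Sum>v\<in>U0. \<Sum>u\<in>U0. if u \<in> T z \<and> v \<in> T z then g v u else 0)"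
        using g0 fin by (intro sum_mono2 sum_nonneg) (auto simp: T_def)
      finally show ?thesis .
    qed
    then have "(\<Sum>z\<in>Z \<times> Z. energy g (T z))
        \<le> (\<Sum>z\<in>Z \<times> Z. \<Sum>v\<in>U0. \<Sum>u\<in>U0. if u \<in> T z \<and> v \<in> T z then g v u else 0)"
      by (intro sum_mono) auto
    also have "\<dots> = (\<Sum>v\<in>U0. \<Sum>u\<in>U0. \<Sum>z\<in>Z \<times> Z. if u \<in> T z \<and> v \<in> T z then g v u else 0)"
      by (subst sum.swap, rule sum.cong[OF refl], rule sum.swap)
    also have "\<dots> \<le> (\<Sum>v\<in>U0. \<Sum>u\<in>U0. real (card Z))"
    proof (intro sum_mono)
      fix v u assume vu: "v \<in> U0" "u \<in> U0"
      have "(\<Sum>z\<in>Z \<times> Z. if u \<in> T z \<and> v \<in> T z then g v u else 0)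
          = card {z \<in> Z \<times> Z. fst z \<in> N v \<inter> N u \<and> snd z \<in> N v \<inter> N u} * g v u"
        using fin vu by (simp add: sum.If_cases T_def Int_def conj.left_commute conj.commute)
      also have "\<dots> = (card (N v \<inter> N u))\<^sup>2 * g v u"
        using N(1)[OF vu(1)] by (subst sq) auto
      also have "\<dots> = card (N v \<inter> N u)"
        by (simp add: g_def power2_eq_square)
      also have "\<dots> \<le> card Z"
        using N(1)[OF vu(1)] fin(2) by (intro of_nat_mono card_mono) auto
      finally show "(\<Sum>z\<in>Z \<times> Z. if u \<in> T z \<and> v \<in> T z then g v u else 0) \<le> real (card Z)" .
    qed
    finally show ?thesis by (simp add: power2_eq_square)
  qed
  then have "\<rho>\<^sup>2 * (\<Sum>z\<in>Z \<times> Z. energy g (T z)) \<le> \<rho>\<^sup>2 * ((card U0)\<^sup>2 * card Z)"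
    by (intro mult_left_mono) auto
  moreover have "2 * card U0 * card Z * (\<Sum>z\<in>Z \<times> Z. real (card (T z)))
      \<ge> 2 * card U0 * card Z * (card U0 * \<rho>\<^sup>2)"
    using size by (intro mult_left_mono) auto
  moreover have "(\<Sum>z\<in>Z \<times> Z. h z) = 2 * card U0 * card Z * (\<Sum>z\<in>Z \<times> Z. real (card (T z)))
      - \<rho>\<^sup>2 * (\<Sum>z\<in>Z \<times> Z. energy g (T z))"
    unfolding h_def by (simp add: sum_subtractf sum_distrib_left)
  ultimately have "(\<Sum>z\<in>Z \<times> Z. h z) \<ge> \<rho>\<^sup>2 * (card U0)\<^sup>2 * card Z"
    by (simp add: power2_eq_square algebra_simps)
  have "\<exists>z\<in>Z \<times> Z. h z \<ge> \<rho>\<^sup>2 * (card U0)\<^sup>2 / card Z"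
  proof (rule ccontr)
    assume "\<not> ?thesis"
    then have "(\<Sum>z\<in>Z \<times> Z. h z) < (\<Sum>z\<in>Z \<times> Z. \<rho>\<^sup>2 * (card U0)\<^sup>2 / card Z)"
      using fin \<open>Z \<noteq> {}\<close> by (intro sum_strict_mono) (auto simp: not_le)
    also have "\<dots> = \<rho>\<^sup>2 * (card U0)\<^sup>2 * card Z"
      using pos by (simp add: card_cartesian_product)
    finally show False using \<open>(\<Sum>z\<in>Z \<times> Z. h z) \<ge> _\<close> by simp
  qed
  then obtain z where z: "h z \<ge> \<rho>\<^sup>2 * (card U0)\<^sup>2 / card Z" by blast
  have e0: "\<rho>\<^sup>2 * energy g (T z) \<ge> 0"
    unfolding energy_def g_def by (intro mult_nonneg_nonneg sum_nonneg) auto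
  show ?thesis
  proof
    show "T z \<subseteq> U0" by (auto simp: T_def)
    show "N u \<inter> N v \<noteq> {}" if "u \<in> T z" "v \<in> T z" for u v
      using that by (auto simp: T_def)
    have "h z \<ge> 0" by (rule order_trans[OF _ z]) simp
    then show "\<rho>\<^sup>2 * energy (\<lambda>u v. 1 / card (N u \<inter> N v)) (T z) \<le> 2 * card U0 * card Z * card (T z)"
      by (simp add: h_def g_def[abs_def])
    have "\<rho>\<^sup>2 * (card U0)\<^sup>2 / card Z \<le> 2 * card U0 * card Z * card (T z)"
      using z e0 by (simp add: h_def)
    then have "real (card U0) * (\<rho>\<^sup>2 * card U0) \<le> card U0 * (2 * (card Z)\<^sup>2 * card (T z))"
      using pos by (simp add: field_simps power2_eq_square)
    then show "\<rho>\<^sup>2 * card U0 \<le> 2 * (card Z)\<^sup>2 * card (T z)"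
      using pos by (simp add: mult_le_cancel_left)
  qed
qed

text \<open>
  First discard the points with large row sums, which costs at most half of the points since
  the mean row sum is at most \<open>D\<close>; then keep the largest class of a balanced partition
  into \<open>r\<close> parts, in which all row sums have dropped by the factor \<open>r\<close>.
\<close>
lemma small_row_subset:
  fixes g :: "'a \<Rightarrow> 'a \<Rightarrow> real" and D :: real and r :: nat
  assumes "finite U" "r > 0" "D > 0" and sym: "\<And>u v. g u v = g v u"
    and nonneg: "\<And>u v. g u v \<ge> 0" and en: "energy g U \<le> D * card U"
  obtains V where "V \<subseteq> U" "card U \<le> 2 * r * card V"
    "\<And>v. v \<in> V \<Longrightarrow> r * (\<Sum>u\<in>V - {v}. g v u) \<le> D"
proof -
  have symn: "- g u v = - g v u" for u v using sym[of u v] by simp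
  obtain V where V: "V \<subseteq> U"
      "energy (\<lambda>u v. - g u v) U - (- 2 * D) * card U \<le> energy (\<lambda>u v. - g u v) V - (- 2 * D) * card V"
      "\<And>v. v \<in> V \<Longrightarrow> - 2 * D \<le> 2 * (\<Sum>u\<in>V - {v}. - g v u)"
    by (rule energy_core[where w = "\<lambda>u v. - g u v" and t = "- 2 * D", OF assms(1) symn]) (rule that)
  have neg: "energy (\<lambda>u v. - g u v) S = - energy g S" for S
    by (simp add: energy_def sum_negf)
  have "energy g V \<ge> 0" unfolding energy_def by (intro sum_nonneg nonneg)
  then have "D * card U \<le> D * (2 * card V)" using V(2) en by (simp add: neg)
  then have half: "card U \<le> 2 * card V" using \<open>D > 0\<close> by simp
  have row: "(\<Sum>u\<in>V - {v}. g v u) \<le> D" if "v \<in> V" for v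
    using V(3)[OF that] by (simp add: sum_negf)
  have fV: "finite V" using V(1) assms(1) finite_subset by blast
  obtain f where f: "\<And>v. v \<in> V \<Longrightarrow> f v < r"
    "\<And>v. v \<in> V \<Longrightarrow> r * (\<Sum>u | u \<in> V - {v} \<and> f u = f v. g v u) \<le> (\<Sum>u\<in>V - {v}. g v u)"
    by (rule balanced_partition[where w = g, OF fV \<open>r > 0\<close> sym]) (rule that)
  have "\<exists>j<r. card V \<le> r * card {v \<in> V. f v = j}"
  proof (rule ccontr)
    assume "\<not> ?thesis"
    then have less: "r * card {v \<in> V. f v = j} < card V" if "j < r" for j using that by auto
    have "card V = (\<Sum>j<r. card {v \<in> V. f v = j})"
      using sum.group[of V "{..<r}" f "\<lambda>_. 1::nat"] fV f(1) by (simp add: image_subset_iff)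
    then have "r * card V = (\<Sum>j<r. r * card {v \<in> V. f v = j})" by (simp add: sum_distrib_left)
    also have "\<dots> < (\<Sum>j<r. card V)" using less \<open>r > 0\<close> by (intro sum_strict_mono) auto
    finally show False by simp
  qed
  then obtain j where j: "card V \<le> r * card {v \<in> V. f v = j}" by blast
  show ?thesis
  proof
    show "{v \<in> V. f v = j} \<subseteq> U" using V(1) by blast
    show "card U \<le> 2 * r * card {v \<in> V. f v = j}" using half j by simp
    fix v assume v: "v \<in> {v \<in> V. f v = j}"
    then have "{v \<in> V. f v = j} - {v} = {u. u \<in> V - {v} \<and> f u = f v}" by auto
    then show "r * (\<Sum>u\<in>{v \<in> V. f v = j} - {v}. g v u) \<le> D"
      using f(2)[of v] row[of v] v by simp
  qed
qed

section \<open>Linkages in bipartite graphs of nearly regular degree\<close>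

text \<open>
  The data of a clique subdivision with branch vertices \<open>U\<close> in which every edge becomes a path
  \<open>u, con u {u, v}, mid {u, v}, con v {u, v}, v\<close> of length 4.  The middle vertex depends on
  the unordered pair only, so that the path from \<open>v\<close> to \<open>u\<close> is the reverse of the
  one from \<open>u\<close> to \<open>v\<close>; the last three conditions make different paths internally
  disjoint.
\<close>
definition linkage :: "'a rel \<Rightarrow> 'a set \<Rightarrow> ('a set \<Rightarrow> 'a) \<Rightarrow> ('a \<Rightarrow> 'a set \<Rightarrow> 'a) \<Rightarrow> bool" where
  "linkage E U mid con \<longleftrightarrow>
    (\<forall>u\<in>U. \<forall>v\<in>U - {u}. (u, con u {u, v}) \<in> E \<and> (con u {u, v}, mid {u, v}) \<in> E
       \<and> mid {u, v} \<notin> U \<and> con u {u, v} \<notin> U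
       \<and> (\<forall>x\<in>U. \<forall>y\<in>U - {x}. con u {u, v} \<noteq> mid {x, y}
            \<and> (mid {u, v} = mid {x, y} \<longrightarrow> {u, v} = {x, y})
            \<and> (con u {u, v} = con x {x, y} \<longrightarrow> u = x \<and> v = y)))"

text \<open>
  The parts of the bipartite graph are \<open>B\<close> and its complement.  All branch vertices will be
  neighbours of the fixed vertex \<open>x\<close>; as two of them have no common neighbour other than
  \<open>x\<close>, their remaining neighbourhoods are disjoint.
\<close>
locale c4free_bipartite =
  fixes V :: "'a set" and F :: "'a rel" and B :: "'a set" and \<Delta> :: nat and x :: 'a
  assumes fin: "finite V" and F_sub: "F \<subseteq> V \<times> V" and F_sym: "sym F"
    and bip: "(u, v) \<in> F \<Longrightarrow> u \<in> B \<longleftrightarrow> v \<notin> B"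
    and c4: "(u, a) \<in> F \<Longrightarrow> (a, v) \<in> F \<Longrightarrow> (u, b) \<in> F \<Longrightarrow> (b, v) \<in> F \<Longrightarrow> u \<noteq> v \<Longrightarrow> a = b"
    and maxdeg: "v \<in> V \<Longrightarrow> card (F `` {v}) \<le> \<Delta>"
begin

text \<open>
  The possible middle vertices of a path of length 4 starting at \<open>u\<close>.  A vertex adjacent to
  \<open>x\<close> is left out: its common neighbour with \<open>u \<in> F `` {x}\<close> would be \<open>x\<close> itself,
  which all branch vertices share.
\<close>
definition reach :: "'a \<Rightarrow> 'a set" where
  "reach u = {w \<in> V - F `` {x}. \<exists>a. (u, a) \<in> F \<and> (a, w) \<in> F}"

definition conn :: "'a \<Rightarrow> 'a \<Rightarrow> 'a" where
  "conn u w = (SOME a. (u, a) \<in> F \<and> (a, w) \<in> F)"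

lemma F_symD: "(u, v) \<in> F \<Longrightarrow> (v, u) \<in> F"
  using F_sym by (rule symD)

lemma conn_arcs: "w \<in> reach u \<Longrightarrow> (u, conn u w) \<in> F \<and> (conn u w, w) \<in> F"
  unfolding reach_def conn_def by (rule someI_ex) blast

lemma finite_nbhd: "finite (F `` {v})"
  using F_sub fin by (auto intro: finite_subset[of _ V])

lemma finite_reach: "finite (reach u)"
  using fin by (simp add: reach_def)

lemma card_nbhd: "card (F `` {v}) \<le> \<Delta>"
proof (cases "v \<in> V")
  case False
  then have "F `` {v} = {}" using F_sub by auto
  then show ?thesis by simp
qed (rule maxdeg)

lemma not_meet_again:
  assumes "u \<in> F `` {x}" "(u, a) \<in> F" "(a, w) \<in> F" "w \<noteq> u" "a \<noteq> x"
  shows "w \<notin> F `` {x}"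
proof
  assume "w \<in> F `` {x}"
  then show False using c4[of u a w x] assms F_symD by blast
qed

text \<open>
  Going from \<open>u\<close> to its neighbours other than \<open>x\<close> and on to theirs, no vertex other
  than \<open>u\<close> is reached twice, since that would close a 4-cycle, and none that is adjacent to
  \<open>x\<close>, for the same reason.
\<close>
lemma card_reach:
  fixes \<delta> :: real
  assumes "\<delta> > 0" and deg: "\<And>v. v \<in> V \<Longrightarrow> \<delta> + 1 \<le> card (F `` {v})" and u: "u \<in> F `` {x}"
  shows "\<delta>\<^sup>2 \<le> card (reach u)"
proof -
  let ?A = "F `` {u} - {x}"
  have "(\<Union>a\<in>?A. F `` {a} - {u}) \<subseteq> reach u"
    using not_meet_again[OF u] F_sub unfolding reach_def by auto
  then have "card (\<Union>a\<in>?A. F `` {a} - {u}) \<le> card (reach u)"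
    by (rule card_mono[OF finite_reach])
  moreover have "card (\<Union>a\<in>?A. F `` {a} - {u}) = (\<Sum>a\<in>?A. card (F `` {a} - {u}))"
  proof (rule card_UN_disjoint)
    show "\<forall>a\<in>?A. \<forall>b\<in>?A. a \<noteq> b \<longrightarrow> (F `` {a} - {u}) \<inter> (F `` {b} - {u}) = {}"
      using c4 by blast
  qed (use finite_nbhd in auto)
  ultimately have "(\<Sum>a\<in>?A. real (card (F `` {a} - {u}))) \<le> card (reach u)"
    by (metis of_nat_le_iff of_nat_sum)
  moreover have "(\<Sum>a\<in>?A. \<delta>) \<le> (\<Sum>a\<in>?A. real (card (F `` {a} - {u})))"
  proof (rule sum_mono)
    fix a assume "a \<in> ?A"
    then have "a \<in> V" "u \<in> F `` {a}" using F_sub F_symD by auto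
    then show "\<delta> \<le> card (F `` {a} - {u})"
      using deg[of a] finite_nbhd[of a] by (simp add: card_Diff_singleton)
  qed
  moreover have "\<delta> \<le> card ?A"
  proof -
    have "u \<in> V" "x \<in> F `` {u}" using u F_sub F_symD by auto
    then show ?thesis using deg[of u] finite_nbhd[of u] by (simp add: card_Diff_singleton)
  qed
  then have "\<delta> * \<delta> \<le> card ?A * \<delta>" using \<open>\<delta> > 0\<close> by (intro mult_right_mono) auto
  ultimately show ?thesis by (simp add: power2_eq_square)
qed

text \<open>
  The pairs choose their middle vertices greedily, pairs with few candidates first.  Let the pair
  \<open>{u, v}\<close> have \<open>k\<close> candidates.  The row condition gives that \<open>u\<close> and \<open>v\<close> belong
  to at most \<open>k / (4 * \<Delta>)\<close> pairs each that chose earlier; such a pair blocks one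
  neighbour of \<open>u\<close> or \<open>v\<close> and with it at most \<open>\<Delta>\<close> candidates, besides its own
  middle vertex.  There are at most \<open>\<Delta>\<close> branch vertices, so at most \<open>k / 4\<close> pairs
  chose earlier altogether.  This blocks at most \<open>3 * k / 4\<close> candidates.
\<close>
lemma linkage_of_small_rows:
  assumes U: "U \<subseteq> F `` {x}"
    and pos: "\<And>u v. u \<in> U \<Longrightarrow> v \<in> U \<Longrightarrow> reach u \<inter> reach v \<noteq> {}"
    and row: "\<And>u. u \<in> U \<Longrightarrow> 4 * \<Delta> * (\<Sum>v\<in>U - {u}. 1 / card (reach u \<inter> reach v)) \<le> 1"
  obtains mid con where "linkage F U mid con"
proof -
  define I where "I = {{u, v} | u v. u \<in> U \<and> v \<in> U \<and> u \<noteq> v}"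
  define C where "C p = \<Inter> (reach ` p)" for p
  define conf where "conf p c q d \<longleftrightarrow> c = d \<or> (\<exists>u\<in>p \<inter> q. conn u c = conn u d)" for p c q d
  define b where "b p q = 1 + (if p \<inter> q = {} then 0 else \<Delta>)" for p q :: "'a set"
  define M where "M u k = {v \<in> U - {u}. card (reach u \<inter> reach v) \<le> k}" for u k
  have finU: "finite U" using U finite_nbhd finite_subset by blast
  have cardU: "card U \<le> \<Delta>" using card_mono[OF finite_nbhd U] card_nbhd[of x] by linarith
  have M: "4 * \<Delta> * card (M u k) \<le> k" if u: "u \<in> U" for u k
  proof (cases "M u k = {}")
    case False
    have finM: "finite (M u k)" using finU by (simp add: M_def)
    have pos': "card (reach u \<inter> reach v) > 0" if "v \<in> M u k" for v
      using pos[OF u, of v] that finite_reach by (auto simp: M_def card_gt_0_iff)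
    then have "k > 0" using False by (fastforce simp: M_def)
    have "(\<Sum>v\<in>M u k. 1 / real k) \<le> (\<Sum>v\<in>M u k. 1 / card (reach u \<inter> reach v))"
    proof (rule sum_mono)
      fix v assume v: "v \<in> M u k"
      then have "card (reach u \<inter> reach v) \<le> k" by (simp add: M_def)
      then show "1 / real k \<le> 1 / card (reach u \<inter> reach v)"
        using pos'[OF v] by (simp add: frac_le)
    qed
    also have "\<dots> \<le> (\<Sum>v\<in>U - {u}. 1 / card (reach u \<inter> reach v))"
      using finU by (intro sum_mono2) (auto simp: M_def)
    finally have "4 * \<Delta> * (card (M u k) / real k) \<le> 4 * \<Delta> * (\<Sum>v\<in>U - {u}. 1 / card (reach u \<inter> reach v))"
      by (intro mult_left_mono) auto
    also have "\<dots> \<le> 1" using row[OF u] by simp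
    finally have "real (4 * \<Delta> * card (M u k)) \<le> k" using \<open>k > 0\<close> by (simp add: field_simps)
    then show ?thesis by (simp only: of_nat_le_iff)
  qed simp
  have I: "\<exists>u v. p = {u, v} \<and> u \<in> U \<and> v \<in> U \<and> u \<noteq> v" if "p \<in> I" for p
    using that by (auto simp: I_def)
  have finI: "finite I"
    by (rule finite_subset[of _ "Pow U"]) (use finU in \<open>auto simp: I_def\<close>)
  have "\<exists>f. (\<forall>p\<in>I. f p \<in> C p) \<and> (\<forall>p\<in>I. \<forall>q\<in>I. p \<noteq> q \<longrightarrow> \<not> conf p (f p) q (f q))"
  proof (rule greedy_choice[where rank = "\<lambda>p. card (C p)" and b = b])
    show "finite (C p)" if "p \<in> I" for p
      using I[OF that] finite_reach by (auto simp: C_def)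
    show "conf q d p c" if "conf p c q d" for p c q d
      using that unfolding conf_def by (metis Int_commute)
    fix p q d assume p: "p \<in> I" and q: "q \<in> I" and "p \<noteq> q"
    obtain u v where uv: "p = {u, v}" "u \<noteq> v" using I[OF p] by blast
    obtain u' v' where uv': "q = {u', v'}" "u' \<noteq> v'" using I[OF q] by blast
    show "card {c \<in> C p. conf p c q d} \<le> b p q"
    proof (cases "p \<inter> q = {}")
      case True
      then have "{c \<in> C p. conf p c q d} \<subseteq> {d}" by (auto simp: conf_def)
      then have "card {c \<in> C p. conf p c q d} \<le> card {d}" by (intro card_mono) auto
      then show ?thesis by (simp add: b_def)
    next
      case False
      then obtain y where y: "p \<inter> q = {y}" using uv uv' \<open>p \<noteq> q\<close> by auto
      have "{c \<in> C p. conf p c q d} \<subseteq> insert d (F `` {conn y d})"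
      proof
        fix c assume c: "c \<in> {c \<in> C p. conf p c q d}"
        show "c \<in> insert d (F `` {conn y d})"
        proof (cases "c = d")
          case False
          then have "conn y c = conn y d" using c y by (auto simp: conf_def)
          moreover have "c \<in> reach y" using c y by (auto simp: C_def)
          ultimately show ?thesis using conn_arcs[of c y] by auto
        qed simp
      qed
      then have "card {c \<in> C p. conf p c q d} \<le> card (insert d (F `` {conn y d}))"
        using finite_nbhd by (intro card_mono) auto
      also have "\<dots> \<le> 1 + \<Delta>"
        using card_nbhd[of "conn y d"] finite_nbhd by (simp add: card_insert_if)
      finally show ?thesis using False by (simp add: b_def)
    qed
  next
    fix p assume p: "p \<in> I"
    define k where "k = card (C p)"
    define J where "J = {q. q \<in> I \<and> q \<noteq> p \<and> card (C q) \<le> card (C p)}"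
    obtain u v where uv: "p = {u, v}" "u \<in> U" "v \<in> U" "u \<noteq> v" using I[OF p] by blast
    have "k > 0" using pos[OF uv(2,3)] finite_reach by (simp add: k_def C_def uv(1) card_gt_0_iff)
    have finM: "finite (M w k)" for w using finU by (simp add: M_def)
    have finJ: "finite J" using finI by (simp add: J_def)
    have J: "\<exists>z\<in>M w k. q = {w, z}" if qJ: "q \<in> J" and wq: "w \<in> q" for q w
    proof -
      have "q \<in> I" "card (C q) \<le> k" using qJ by (auto simp: J_def k_def)
      then obtain w1 w2 where q: "q = {w1, w2}" "w1 \<in> U" "w2 \<in> U" "w1 \<noteq> w2" using I by blast
      then obtain z where z: "q = {w, z}" "w \<in> U" "z \<in> U" "w \<noteq> z" using wq by blast
      then show ?thesis using \<open>card (C q) \<le> k\<close> by (auto simp: M_def C_def)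
    qed
    have bound: "card {q \<in> J. q \<inter> W \<noteq> {}} \<le> (\<Sum>w\<in>W. card (M w k))" if "finite W" for W
    proof -
      have "{q \<in> J. q \<inter> W \<noteq> {}} \<subseteq> (\<Union>w\<in>W. (\<lambda>z. {w, z}) ` M w k)" using J by blast
      then have "card {q \<in> J. q \<inter> W \<noteq> {}} \<le> card (\<Union>w\<in>W. (\<lambda>z. {w, z}) ` M w k)"
        using that finM by (intro card_mono) auto
      also have "\<dots> \<le> (\<Sum>w\<in>W. card ((\<lambda>z. {w, z}) ` M w k))" using that by (rule card_UN_le)
      also have "\<dots> \<le> (\<Sum>w\<in>W. card (M w k))" using finM by (intro sum_mono card_image_le)
      finally show ?thesis .
    qed
    have "J = {q \<in> J. q \<inter> U \<noteq> {}}" using I by (auto simp: J_def)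
    then have "card J \<le> (\<Sum>w\<in>U. card (M w k))" using bound[OF finU] by simp
    then have "4 * \<Delta> * card J \<le> (\<Sum>w\<in>U. 4 * \<Delta> * card (M w k))"
      by (simp add: sum_distrib_left[symmetric])
    also have "\<dots> \<le> (\<Sum>w\<in>U. k)" using M by (intro sum_mono)
    also have "\<dots> \<le> \<Delta> * k" using cardU by simp
    finally have 1: "4 * \<Delta> * card J \<le> \<Delta> * k" .
    have "card {q \<in> J. q \<inter> p \<noteq> {}} \<le> card (M u k) + card (M v k)"
      using bound[of p] uv by simp
    then have "4 * (\<Delta> * card {q \<in> J. q \<inter> p \<noteq> {}}) \<le> 4 * \<Delta> * card (M u k) + 4 * \<Delta> * card (M v k)"
      by (simp add: add_mult_distrib2[symmetric])
    then have 2: "4 * (\<Delta> * card {q \<in> J. q \<inter> p \<noteq> {}}) \<le> 2 * k"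
      using M[OF uv(2), of k] M[OF uv(3), of k] by linarith
    have "\<Delta> > 0" using cardU uv(2) finU by (metis card_gt_0_iff empty_iff gr0I le_zero_eq)
    then have 3: "4 * card J \<le> k" using 1 by simp
    have "(\<Sum>q\<in>J. b p q) = (\<Sum>q\<in>J. 1 + (if q \<inter> p \<noteq> {} then \<Delta> else 0))"
      by (intro sum.cong refl) (simp add: b_def Int_commute)
    also have "\<dots> = card J + (\<Sum>q\<in>J. if q \<inter> p \<noteq> {} then \<Delta> else 0)"
      by (simp only: sum.distrib card_eq_sum)
    also have "(\<Sum>q\<in>J. if q \<inter> p \<noteq> {} then \<Delta> else 0) = \<Delta> * card {q \<in> J. q \<inter> p \<noteq> {}}"
      using finJ by (simp add: sum.If_cases Int_def)
    finally have "(\<Sum>q\<in>J. b p q) < k" using 2 3 \<open>k > 0\<close> by linarith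
    then show "(\<Sum>q | q \<in> I \<and> q \<noteq> p \<and> card (C q) \<le> card (C p). b p q) < card (C p)"
      by (simp add: J_def k_def)
  qed (rule finI)
  then obtain f where "(\<forall>p\<in>I. f p \<in> C p) \<and> (\<forall>p\<in>I. \<forall>q\<in>I. p \<noteq> q \<longrightarrow> \<not> conf p (f p) q (f q))"
    by (rule exE)
  then have f: "\<And>p. p \<in> I \<Longrightarrow> f p \<in> C p"
    "\<And>p q. p \<in> I \<Longrightarrow> q \<in> I \<Longrightarrow> p \<noteq> q \<Longrightarrow> \<not> conf p (f p) q (f q)" by simp_all
  define con where "con u p = conn u (f p)" for u p
  have inI: "{u, v} \<in> I" if "u \<in> U" "v \<in> U - {u}" for u v using that by (auto simp: I_def)
  have path: "(u, con u {u, v}) \<in> F" "(con u {u, v}, f {u, v}) \<in> F" "f {u, v} \<notin> F `` {x}"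
    if "u \<in> U" "v \<in> U - {u}" for u v
  proof -
    have "f {u, v} \<in> reach u" using f(1)[OF inI[OF that]] by (simp add: C_def)
    then show "(u, con u {u, v}) \<in> F" "(con u {u, v}, f {u, v}) \<in> F" "f {u, v} \<notin> F `` {x}"
      using conn_arcs[of "f {u, v}" u] by (auto simp: con_def reach_def)
  qed
  \<comment> \<open>Branch and middle vertices lie on one side, the connecting vertices on the side of
    \<open>x\<close>.\<close>
  have side: "u \<in> B \<longleftrightarrow> x \<notin> B" if "u \<in> U" for u using U that bip[of x u] by auto
  have cside: "con u {u, v} \<in> B \<longleftrightarrow> x \<in> B" if "u \<in> U" "v \<in> U - {u}" for u v
    using path(1)[OF that] side[OF that(1)] bip by blast
  have mside: "f {u, v} \<in> B \<longleftrightarrow> x \<notin> B" if "u \<in> U" "v \<in> U - {u}" for u v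
    using path(2)[OF that] cside[OF that] bip by blast
  have con_inj: "u = y \<and> v = z"
    if uv: "u \<in> U" "v \<in> U - {u}" and yz: "y \<in> U" "z \<in> U - {y}"
      and eq: "con u {u, v} = con y {y, z}" for u v y z
  proof -
    \<comment> \<open>A vertex adjacent to two branch vertices is \<open>x\<close>, and the middle vertices are not
      adjacent to \<open>x\<close>.\<close>
    have "u = y"
    proof (rule ccontr)
      assume "u \<noteq> y"
      have "(u, x) \<in> F" "(x, y) \<in> F" using uv yz U F_symD by auto
      then have "con u {u, v} = x"
        using c4[of u "con u {u, v}" y x] path(1)[OF uv] path(1)[OF yz] F_symD \<open>u \<noteq> y\<close> eq by simp
      then show False using path(2,3)[OF uv] by simp
    qed
    moreover have "{u, v} = {y, z}"
    proof (rule ccontr)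
      assume "{u, v} \<noteq> {y, z}"
      then have "\<not> conf {u, v} (f {u, v}) {y, z} (f {y, z})" by (rule f(2)[OF inI[OF uv] inI[OF yz]])
      then show False using \<open>u = y\<close> eq by (simp add: conf_def con_def)
    qed
    ultimately show ?thesis using uv(2) yz(2) by (auto simp: doubleton_eq_iff)
  qed
  have "linkage F U f con"
    unfolding linkage_def
  proof (intro ballI conjI impI)
    fix u v assume uv: "u \<in> U" "v \<in> U - {u}"
    show "(u, con u {u, v}) \<in> F" "(con u {u, v}, f {u, v}) \<in> F" using path[OF uv] by auto
    show "f {u, v} \<notin> U" using path(3)[OF uv] U by blast
    show "con u {u, v} \<notin> U" using cside[OF uv] side by blast
    fix y z assume yz: "y \<in> U" "z \<in> U - {y}"
    show "con u {u, v} \<noteq> f {y, z}" using cside[OF uv] mside[OF yz] by metis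
    show "{u, v} = {y, z}" if "f {u, v} = f {y, z}"
      using f(2)[OF inI[OF uv] inI[OF yz]] that by (auto simp: conf_def)
    show "u = y" "v = z" if "con u {u, v} = con y {y, z}" using con_inj[OF uv yz that] by auto
  qed
  then show ?thesis by (rule that)
qed

text \<open>
  If \<open>\<delta>\<close>, \<open>\<Delta>\<close> and the square root of \<open>card V\<close> agree up to constant factors,
  a constant \<open>r\<close> satisfies the hypothesis and the linkage has of the order of \<open>\<delta>\<close>
  branch vertices.
\<close>
lemma large_linkage:
  fixes \<delta> :: real and r :: nat
  assumes "x \<in> V" "\<delta> > 0" "r > 0"
    and deg: "\<And>v. v \<in> V \<Longrightarrow> \<delta> + 1 \<le> card (F `` {v})"
    and r: "8 * \<Delta>\<^sup>2 * card V \<le> r * \<delta> ^ 4"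
  obtains U mid con where "U \<subseteq> V" "linkage F U mid con" "\<delta> ^ 5 \<le> 4 * r * (card V)\<^sup>2 * card U"
proof -
  define g where "g u v = 1 / real (card (reach u \<inter> reach v))" for u v
  \<comment> \<open>The bound on the mean row sum that dependent random choice provides; the factor \<open>r\<close>
    brings it down to \<open>1 / (4 * \<Delta>)\<close>.\<close>
  define D where "D = 2 * \<Delta> * card V / \<delta> ^ 4"
  have degx: "\<delta> + 1 \<le> card (F `` {x})" by (rule deg[OF \<open>x \<in> V\<close>])
  then have "F `` {x} \<noteq> {}" using \<open>\<delta> > 0\<close> by auto
  have "\<Delta> > 0" using degx card_nbhd[of x] \<open>\<delta> > 0\<close> by linarith
  have "card V > 0" using \<open>x \<in> V\<close> fin card_gt_0_iff by blast
  have "D > 0" using \<open>\<Delta> > 0\<close> \<open>card V > 0\<close> \<open>\<delta> > 0\<close> by (simp add: D_def)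
  obtain U1 where U1: "U1 \<subseteq> F `` {x}" "(\<delta>\<^sup>2)\<^sup>2 * card (F `` {x}) \<le> 2 * (card V)\<^sup>2 * card U1"
    "\<And>u v. u \<in> U1 \<Longrightarrow> v \<in> U1 \<Longrightarrow> reach u \<inter> reach v \<noteq> {}"
    "(\<delta>\<^sup>2)\<^sup>2 * energy (\<lambda>u v. 1 / card (reach u \<inter> reach v)) U1 \<le> 2 * card (F `` {x}) * card V * card U1"
  proof (rule two_point_common_nbhd[where N = reach and Z = V and \<rho> = "\<delta>\<^sup>2"])
    show "finite (F `` {x})" by (rule finite_nbhd)
    show "reach u \<subseteq> V" for u by (auto simp: reach_def)
    show "\<delta>\<^sup>2 \<le> card (reach u)" if "u \<in> F `` {x}" for u by (rule card_reach[OF \<open>\<delta> > 0\<close> deg that])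
  qed (use fin \<open>F `` {x} \<noteq> {}\<close> \<open>\<delta> > 0\<close> in \<open>auto intro: that\<close>)
  have "\<delta> ^ 4 * energy g U1 \<le> 2 * card (F `` {x}) * card V * card U1"
    using U1(4) by (simp add: g_def[abs_def])
  also have "\<dots> \<le> 2 * \<Delta> * card V * card U1"
    using card_nbhd[of x] by (intro of_nat_mono mult_le_mono) auto
  finally have "energy g U1 \<le> D * card U1"
    using \<open>\<delta> > 0\<close> by (simp add: D_def field_simps)
  moreover have "finite U1" using U1(1) finite_nbhd finite_subset by blast
  moreover have "g u v = g v u" "g u v \<ge> 0" for u v by (simp_all add: g_def Int_commute)
  ultimately obtain U where U: "U \<subseteq> U1" "card U1 \<le> 2 * r * card U"
    "\<And>u. u \<in> U \<Longrightarrow> r * (\<Sum>v\<in>U - {u}. g u v) \<le> D"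
    using small_row_subset[of U1 r D g] \<open>r > 0\<close> \<open>D > 0\<close> by metis
  have "4 * \<Delta> * D \<le> r"
  proof -
    have "4 * \<Delta> * D = 8 * \<Delta>\<^sup>2 * card V / \<delta> ^ 4" by (simp add: D_def power2_eq_square)
    also have "\<dots> \<le> r" using r \<open>\<delta> > 0\<close> by (simp add: divide_le_eq)
    finally show ?thesis .
  qed
  have row: "4 * \<Delta> * (\<Sum>v\<in>U - {u}. 1 / card (reach u \<inter> reach v)) \<le> 1" if "u \<in> U" for u
  proof -
    have "4 * \<Delta> * (r * (\<Sum>v\<in>U - {u}. g u v)) \<le> 4 * \<Delta> * D"
      using U(3)[OF that] by (intro mult_left_mono) auto
    also have "\<dots> \<le> r" by fact
    finally have "r * (4 * \<Delta> * (\<Sum>v\<in>U - {u}. g u v)) \<le> r * 1" by (simp add: mult_ac)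
    then show ?thesis using \<open>r > 0\<close> by (simp add: g_def)
  qed
  have "U \<subseteq> F `` {x}" using U(1) U1(1) by blast
  moreover have "reach u \<inter> reach v \<noteq> {}" if "u \<in> U" "v \<in> U" for u v
    using U1(3) U(1) that by blast
  ultimately obtain mid con where "linkage F U mid con"
    using linkage_of_small_rows row by metis
  moreover have "U \<subseteq> V" using \<open>U \<subseteq> F `` {x}\<close> F_sub by blast
  moreover have "\<delta> ^ 5 \<le> 4 * r * (card V)\<^sup>2 * card U"
  proof -
    have "\<delta> ^ 5 = (\<delta>\<^sup>2)\<^sup>2 * \<delta>" by (simp add: eval_nat_numeral)
    also have "\<dots> \<le> (\<delta>\<^sup>2)\<^sup>2 * card (F `` {x})" using degx by (intro mult_left_mono) auto
    also have "\<dots> \<le> 2 * (card V)\<^sup>2 * card U1" by (rule U1(2))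
    also have "\<dots> \<le> 2 * (card V)\<^sup>2 * (2 * r * card U)" using U(2) by (intro of_nat_mono mult_le_mono2)
    finally show ?thesis by (simp add: mult_ac)
  qed
  ultimately show ?thesis using that by blast
qed

end

section \<open>From linkages to subdivisions\<close>

lemma linkage_subset: "linkage E U mid con \<Longrightarrow> L \<subseteq> U \<Longrightarrow> linkage E L mid con"
  unfolding linkage_def by blast

lemma linkage_imp_exact_TK:
  fixes G :: "'a pair_pre_digraph"
  assumes "pair_graph G" and link: "linkage (parcs G) U mid con"
    and "U \<subseteq> pverts G" "finite U" "l \<le> card U"
  shows "contains_exact_TK 3 l G"
proof -
  interpret G: pair_graph G by fact
  obtain L where L: "L \<subseteq> U" "card L = l" using \<open>l \<le> card U\<close> by (rule obtain_subset_with_card_n)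
  have finL: "finite L" using L(1) \<open>finite U\<close> by (rule finite_subset)
  note link_L = linkage_subset[OF link L(1), unfolded linkage_def]
  have path: "(u, con u {u, v}) \<in> parcs G" "(con u {u, v}, mid {u, v}) \<in> parcs G"
      "mid {u, v} \<notin> L" "con u {u, v} \<notin> L"
    if "u \<in> L" "v \<in> L - {u}" for u v
    using bspec[OF bspec[OF link_L that(1)] that(2)] by simp_all
  have apart: "con u {u, v} \<noteq> mid {x, y}"
      "mid {u, v} = mid {x, y} \<Longrightarrow> {u, v} = {x, y}"
      "con u {u, v} = con x {x, y} \<Longrightarrow> u = x \<and> v = y"
    if "u \<in> L" "v \<in> L - {u}" "x \<in> L" "y \<in> L - {x}" for u v x y
    using bspec[OF bspec[OF link_L that(1)] that(2)] that(3,4) by simp_all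
  define P where "P = (\<lambda>(u, v). [(u, con u {u, v}), (con u {u, v}, mid {u, v}),
      (mid {u, v}, con v {u, v}), (con v {u, v}, v)])"
  define K where "K = \<lparr>pverts = L, parcs = {(u, v). (u, v) \<in> L \<times> L \<and> u \<noteq> v}\<rparr>"
  \<comment> \<open>The inner vertices of a walk are its tails except for the first.\<close>
  define H where "H = \<lparr>pverts = L \<union> (\<Union>e\<in>parcs K. set (tl (map fst (P e)))), parcs = (\<Union>e\<in>parcs K. set (P e))\<rparr>"
  have parcsK: "(u, v) \<in> parcs K \<longleftrightarrow> u \<in> L \<and> v \<in> L - {u}" for u v by (auto simp: K_def)
  have inner: "tl (map fst (P (u, v))) = [con u {u, v}, mid {u, v}, con v {u, v}]" for u v
    by (simp add: P_def)
  have *: "(u, con u {u, v}) \<in> parcs G" "(con u {u, v}, mid {u, v}) \<in> parcs G"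
      "(con v {u, v}, v) \<in> parcs G" "(mid {u, v}, con v {u, v}) \<in> parcs G"
      "mid {u, v} \<notin> L" "con u {u, v} \<notin> L" "con v {u, v} \<notin> L"
      "con u {u, v} \<noteq> mid {u, v}" "con v {u, v} \<noteq> mid {u, v}" "con u {u, v} \<noteq> con v {u, v}"
    if "u \<in> L" "v \<in> L - {u}" for u v
  proof -
    have vu: "v \<in> L" "u \<in> L - {v}" "{v, u} = {u, v}" using that by auto
    show "(u, con u {u, v}) \<in> parcs G" "(con u {u, v}, mid {u, v}) \<in> parcs G"
      "(con v {u, v}, v) \<in> parcs G" "(mid {u, v}, con v {u, v}) \<in> parcs G"
      "mid {u, v} \<notin> L" "con u {u, v} \<notin> L" "con v {u, v} \<notin> L"
      "con u {u, v} \<noteq> mid {u, v}" "con v {u, v} \<noteq> mid {u, v}"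
      using path[OF that] path[OF vu(1,2), unfolded vu(3)] apart(1)[OF that that]
        apart(1)[OF vu(1,2) vu(1,2), unfolded vu(3)] by (simp_all add: G.arcs_symmetric)
    show "con u {u, v} \<noteq> con v {u, v}"
      using apart(3)[OF that vu(1,2), unfolded vu(3)] that(2) by auto
  qed
  have fst_snd: "fst e \<in> pverts H \<and> snd e \<in> pverts H" if e: "e \<in> parcs H" for e
  proof -
    obtain u v where uv: "(u, v) \<in> parcs K" "e \<in> set (P (u, v))" using e by (auto simp: H_def)
    have "{u, v} \<union> set (tl (map fst (P (u, v)))) \<subseteq> pverts H"
      using uv(1) by (auto simp: H_def parcsK)
    then show ?thesis using uv(2) unfolding inner by (auto simp: P_def)
  qed
  then interpret H: pair_wf_digraph H by unfold_locales auto
  have "complete_digraph l (with_proj K)"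
    using L finL by (auto simp: complete_digraph_pair_def K_def)
  moreover have "exact_subdivision 3 K H"
    unfolding exact_subdivision_def inner_verts_with_proj_def
  proof (intro exI[of _ P] conjI)
    show "\<forall>(u, v)\<in>parcs K. pre_digraph.gen_iapath (with_proj H) (pverts K) u (P (u, v)) v
        \<and> length (P (u, v)) = 3 + 1 \<and> P (v, u) = rev_path (P (u, v))"
    proof (clarify, intro conjI)
      fix u v assume uvK: "(u, v) \<in> parcs K"
      then have uv: "u \<in> L" "v \<in> L - {u}" by (simp_all add: parcsK)
      have arcs: "set (P (u, v)) \<subseteq> parcs H" using uvK by (auto simp: H_def)
      have vH: "u \<in> pverts H" "v \<in> pverts H" using uv by (auto simp: H_def)
      have "H.apath u (P (u, v)) v"
        unfolding H.apath_def H.awalk_def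
        using arcs vH *[OF uv] uv by (auto simp: P_def)
      then show "pre_digraph.gen_iapath (with_proj H) (pverts K) u (P (u, v)) v"
        unfolding pre_digraph.gen_iapath_def inner_verts_with_proj_def inner
        using uv *[OF uv] by (simp add: K_def P_def)
      show "length (P (u, v)) = 3 + 1" by (simp add: P_def)
      show "P (v, u) = rev_path (P (u, v))" by (simp add: P_def insert_commute)
    qed
    show "\<forall>(u, v)\<in>parcs K. \<forall>(x, y)\<in>parcs K. {u, v} \<noteq> {x, y} \<longrightarrow>
        set (tl (map fst (P (u, v)))) \<inter> set (tl (map fst (P (x, y)))) = {}"
    proof (clarify)
      fix u v x y
      assume uvK: "(u, v) \<in> parcs K" and xyK: "(x, y) \<in> parcs K" and ne: "{u, v} \<noteq> {x, y}"
      have uv: "u \<in> L" "v \<in> L - {u}" and vu: "v \<in> L" "u \<in> L - {v}" "{v, u} = {u, v}"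
        using uvK by (auto simp add: parcsK)
      have xy: "x \<in> L" "y \<in> L - {x}" and yx: "y \<in> L" "x \<in> L - {y}" "{y, x} = {x, y}"
        using xyK by (auto simp add: parcsK)
      show "set (tl (map fst (P (u, v)))) \<inter> set (tl (map fst (P (x, y)))) = {}"
        unfolding inner
        using apart[OF uv xy] apart[OF vu(1,2) xy, unfolded vu(3)]
          apart[OF uv yx(1,2), unfolded yx(3)] apart[OF vu(1,2) yx(1,2), unfolded vu(3) yx(3)]
          apart(1)[OF xy uv] apart(1)[OF yx(1,2) uv, unfolded yx(3)] ne by auto
    qed
  qed (simp_all add: H_def K_def)
  moreover have "subgraph (with_proj H) (with_proj G)"
  proof -
    have "parcs H \<subseteq> parcs G"
    proof
      fix e assume "e \<in> parcs H"
      then obtain u v where uv: "(u, v) \<in> parcs K" "e \<in> set (P (u, v))" by (auto simp: H_def)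
      then have "u \<in> L" "v \<in> L - {u}" by (simp_all add: parcsK)
      from *[OF this] show "e \<in> parcs G" using uv(2) by (auto simp: P_def)
    qed
    moreover have "pverts H \<subseteq> pverts G"
    proof
      fix z assume "z \<in> pverts H"
      then consider "z \<in> L" | u v where "(u, v) \<in> parcs K" "z \<in> set (tl (map fst (P (u, v))))"
        by (auto simp: H_def)
      then show "z \<in> pverts G"
      proof cases
        case 1
        then show ?thesis using L(1) \<open>U \<subseteq> pverts G\<close> by blast
      next
        case 2
        then have "u \<in> L" "v \<in> L - {u}" by (simp_all add: parcsK)
        from *[OF this] show ?thesis using 2(2) G.wellformed' unfolding inner by auto
      qed
    qed
    ultimately show ?thesis
      unfolding subgraph_def compatible_def
      using G.wf_digraph_axioms H.wf_digraph_axioms by simp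
  qed
  ultimately show ?thesis unfolding contains_exact_TK_def by blast
qed

section \<open>Regularising a dense graph without 4-cycles\<close>

lemma C4_free_common_neighbour_unique:
  fixes G :: "'a pair_pre_digraph"
  assumes "pair_graph G" "C4_free G"
    and arcs: "(u, a) \<in> parcs G" "(a, v) \<in> parcs G" "(u, b) \<in> parcs G" "(b, v) \<in> parcs G" and "u \<noteq> v"
  shows "a = b"
proof (rule ccontr)
  assume "a \<noteq> b"
  interpret G: pair_graph G by fact
  let ?p = "[(u, a), (a, v), (v, b), (b, u)]"
  have sym: "(v, b) \<in> parcs G" "(b, u) \<in> parcs G" using arcs G.arcs_symmetric by auto
  have "u \<noteq> a" "a \<noteq> v" "u \<noteq> b" "b \<noteq> v" using arcs G.no_loops' by auto
  then have "G.cycle ?p"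
    unfolding G.cycle_def G.awalk_def
    using arcs sym G.wellformed' \<open>a \<noteq> b\<close> \<open>u \<noteq> v\<close> by auto
  then show False using \<open>C4_free G\<close> unfolding C4_free_def by auto
qed

text \<open>
  The left side counts the triples \<open>(v, a, b)\<close> with \<open>a \<noteq> b\<close> both adjacent to
  \<open>v\<close>, and \<open>v\<close> is determined by \<open>a\<close> and \<open>b\<close>.
\<close>
lemma sum_degree_choose_two:
  assumes "finite V" "E \<subseteq> V \<times> V" "sym E"
    and c4: "\<And>u v a b. (u, a) \<in> E \<Longrightarrow> (a, v) \<in> E \<Longrightarrow> (u, b) \<in> E \<Longrightarrow> (b, v) \<in> E \<Longrightarrow> u \<noteq> v \<Longrightarrow> a = b"
  shows "(\<Sum>v\<in>V. card (E `` {v}) * (card (E `` {v}) - 1)) \<le> (card V)\<^sup>2"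
proof -
  define T where "T v = (SIGMA a:E `` {v}. E `` {v} - {a})" for v
  have sub: "E `` {v} \<subseteq> V" for v using \<open>E \<subseteq> V \<times> V\<close> by blast
  have finE: "finite (E `` {v})" for v using sub \<open>finite V\<close> by (rule finite_subset)
  have "card (T v) = card (E `` {v}) * (card (E `` {v}) - 1)" for v
    unfolding T_def using finE by (subst card_SigmaI) (auto simp: card_Diff_singleton)
  then have "(\<Sum>v\<in>V. card (E `` {v}) * (card (E `` {v}) - 1)) = (\<Sum>v\<in>V. card (T v))" by simp
  also have "\<dots> = card (\<Union>v\<in>V. T v)"
  proof (rule card_UN_disjoint[symmetric])
    show "\<forall>v\<in>V. finite (T v)" unfolding T_def using finE by auto
    show "\<forall>v\<in>V. \<forall>w\<in>V. v \<noteq> w \<longrightarrow> T v \<inter> T w = {}"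
    proof (intro ballI impI equals0I)
      fix v w e assume "v \<noteq> w" "e \<in> T v \<inter> T w"
      then obtain a b where "(v, a) \<in> E" "(v, b) \<in> E" "(w, a) \<in> E" "(w, b) \<in> E" "a \<noteq> b"
        by (auto simp: T_def)
      then show False using c4[of v a w b] symD[OF \<open>sym E\<close>] \<open>v \<noteq> w\<close> by blast
    qed
  qed fact
  also have "\<dots> \<le> card (V \<times> V)"
    using sub \<open>finite V\<close> by (intro card_mono) (auto simp: T_def)
  finally show ?thesis by (simp add: card_cartesian_product power2_eq_square)
qed

lemma energy_eq_card_arcs:
  assumes "finite V" "irrefl E"
  shows "energy (\<lambda>u v. of_bool ((u, v) \<in> E)) V = card (E \<inter> V \<times> V)"
proof -
  have "energy (\<lambda>u v. of_bool ((u, v) \<in> E)) V = (\<Sum>v\<in>V. real (card {u \<in> V. (v, u) \<in> E}))"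
    unfolding energy_def
  proof (rule sum.cong[OF refl])
    fix v assume "v \<in> V"
    have "{u \<in> V. (v, u) \<in> E} = {u \<in> V - {v}. (v, u) \<in> E}"
      using \<open>irrefl E\<close> by (auto simp: irrefl_def)
    then show "(\<Sum>u\<in>V - {v}. of_bool ((v, u) \<in> E)) = real (card {u \<in> V. (v, u) \<in> E})"
      using \<open>finite V\<close> by (simp add: of_bool_def sum.If_cases Int_def)
  qed
  also have "\<dots> = card (SIGMA v:V. {u \<in> V. (v, u) \<in> E})"
    using \<open>finite V\<close> by simp
  also have "(SIGMA v:V. {u \<in> V. (v, u) \<in> E}) = E \<inter> V \<times> V" by auto
  finally show ?thesis .
qed

text \<open>
  A vertex of degree \<open>d > D\<close> accounts for \<open>d * (d - 1) \<ge> D * d / 2\<close> of the at most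
  \<open>(card V)\<^sup>2\<close> triples counted above, so the degrees above \<open>D\<close> add up to at most
  \<open>2 * (card V)\<^sup>2 / D\<close>.
\<close>
lemma few_arcs_at_high_degree:
  fixes E :: "'a rel" and D :: real
  assumes fin: "finite V" and E: "E \<subseteq> V \<times> V" "sym E" and "D \<ge> 1"
    and c4: "\<And>u v a b. (u, a) \<in> E \<Longrightarrow> (a, v) \<in> E \<Longrightarrow> (u, b) \<in> E \<Longrightarrow> (b, v) \<in> E \<Longrightarrow> u \<noteq> v \<Longrightarrow> a = b"
    and V1: "V1 = {v \<in> V. card (E `` {v}) \<le> D}"
  shows "card E \<le> card (E \<inter> V1 \<times> V1) + 4 * (card V)\<^sup>2 / D"
proof -
  define H where "H = V - V1"
  define d where "d v = card (E `` {v})" for v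
  have "finite E" using finite_subset[OF E(1)] fin by simp
  have finH: "finite H" using fin by (simp add: H_def)
  have finE: "finite (E `` {v})" for v using E(1) fin by (auto intro: finite_subset[of _ V])
  have "D * d v \<le> 2 * real (d v * (d v - 1))" if "v \<in> H" for v
  proof -
    have "d v > D" using that by (auto simp: H_def V1 d_def)
    then have "d v \<ge> 2" using \<open>D \<ge> 1\<close> by linarith
    have "D * d v \<le> d v * real (d v)" using \<open>d v > D\<close> by (intro mult_right_mono) auto
    also have "\<dots> \<le> d v * (2 * real (d v - 1))" using \<open>d v \<ge> 2\<close> by (intro mult_left_mono) auto
    finally show ?thesis by simp
  qed
  then have "D * (\<Sum>v\<in>H. real (d v)) \<le> (\<Sum>v\<in>H. 2 * real (d v * (d v - 1)))"
    unfolding sum_distrib_left by (intro sum_mono) auto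
  also have "\<dots> \<le> (\<Sum>v\<in>V. 2 * real (d v * (d v - 1)))"
    using fin by (intro sum_mono2) (auto simp: H_def)
  also have "\<dots> = 2 * real (\<Sum>v\<in>V. d v * (d v - 1))" by (simp add: sum_distrib_left)
  also have "(\<Sum>v\<in>V. d v * (d v - 1)) \<le> (card V)\<^sup>2"
    unfolding d_def by (rule sum_degree_choose_two[OF fin E]) (rule c4)
  finally have "D * (\<Sum>v\<in>H. real (d v)) \<le> 2 * real ((card V)\<^sup>2)" by simp
  then have "(\<Sum>v\<in>H. real (d v)) \<le> 2 * (card V)\<^sup>2 / D"
    using \<open>D \<ge> 1\<close> by (simp add: field_simps)
  moreover have "card E \<le> card (E \<inter> V1 \<times> V1) + 2 * (\<Sum>v\<in>H. d v)"
  proof -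
    define A where "A = (SIGMA v:H. E `` {v})"
    have cA: "card A = (\<Sum>v\<in>H. d v)" unfolding A_def d_def using finH finE by simp
    have "finite A" unfolding A_def using finH finE by auto
    have "E \<subseteq> (E \<inter> V1 \<times> V1) \<union> (A \<union> prod.swap ` A)"
    proof
      fix e assume "e \<in> E"
      obtain u v where e: "e = (u, v)" by (cases e)
      have "(v, u) \<in> E" using \<open>e \<in> E\<close> symD[OF \<open>sym E\<close>] by (simp add: e)
      moreover have "u \<in> V" "v \<in> V" using \<open>e \<in> E\<close> E(1) by (auto simp: e)
      ultimately show "e \<in> (E \<inter> V1 \<times> V1) \<union> (A \<union> prod.swap ` A)"
        using \<open>e \<in> E\<close> by (auto simp: e A_def H_def image_iff)
    qed
    then have "card E \<le> card ((E \<inter> V1 \<times> V1) \<union> (A \<union> prod.swap ` A))"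
      using \<open>finite E\<close> \<open>finite A\<close> by (intro card_mono) auto
    also have "\<dots> \<le> card (E \<inter> V1 \<times> V1) + (card A + card (prod.swap ` A))"
      by (meson card_Un_le add_left_mono order_trans)
    also have "card (prod.swap ` A) \<le> card A" by (rule card_image_le) fact
    finally show ?thesis unfolding cA by simp
  qed
  then have "real (card E) \<le> real (card (E \<inter> V1 \<times> V1)) + 2 * (\<Sum>v\<in>H. real (d v))"
    by (metis of_nat_add of_nat_le_iff of_nat_mult of_nat_numeral of_nat_sum)
  ultimately show ?thesis by (simp add: field_simps)
qed

text \<open>
  A vertex set maximising the number of arcs inside minus \<open>t\<close> times its size has minimum
  degree at least \<open>t / 2\<close>, and in a balanced partition into two classes every vertex keeps
  at least half of its neighbours on the other side.
\<close>
lemma bipartite_min_degree_subgraph: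
  fixes E :: "'a rel" and t :: real
  assumes "finite V" "sym E" "irrefl E" and dense: "card (E \<inter> V \<times> V) > t * card V"
  obtains W B where "W \<subseteq> V" "W \<noteq> {}"
    "\<And>v. v \<in> W \<Longrightarrow> t \<le> 4 * card {u \<in> W. (v, u) \<in> E \<and> (v \<in> B \<longleftrightarrow> u \<notin> B)}"
proof -
  define w where "w u v = (of_bool ((u, v) \<in> E) :: real)" for u v
  have wsym: "w u v = w v u" for u v using symD[OF \<open>sym E\<close>] by (auto simp: w_def)
  obtain W where W: "W \<subseteq> V" "energy w V - t * card V \<le> energy w W - t * card W"
    "\<And>v. v \<in> W \<Longrightarrow> t \<le> 2 * (\<Sum>u\<in>W - {v}. w v u)"
    by (rule energy_core[where w = w and t = t, OF \<open>finite V\<close> wsym]) (rule that)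
  have finW: "finite W" using W(1) \<open>finite V\<close> by (rule finite_subset)
  have "energy w V - t * card V > 0"
    using dense energy_eq_card_arcs[OF \<open>finite V\<close> \<open>irrefl E\<close>] by (simp add: w_def[abs_def])
  then have "W \<noteq> {}" using W(2) by (auto simp: energy_def)
  obtain f where f: "\<And>v. v \<in> W \<Longrightarrow> f v < (2::nat)"
    "\<And>v. v \<in> W \<Longrightarrow> real 2 * (\<Sum>u | u \<in> W - {v} \<and> f u = f v. w v u) \<le> (\<Sum>u\<in>W - {v}. w v u)"
    by (rule balanced_partition[where w = w and r = 2, OF finW _ wsym]) (simp, rule that)
  define B where "B = {v. f v = 0}"
  have side: "f u = f v \<longleftrightarrow> (u \<in> B \<longleftrightarrow> v \<in> B)" if "u \<in> W" "v \<in> W" for u v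
    using f(1)[OF that(1)] f(1)[OF that(2)] by (auto simp: B_def)
  show ?thesis
  proof
    show "W \<subseteq> V" "W \<noteq> {}" by fact+
    fix v assume v: "v \<in> W"
    have "(\<Sum>u\<in>W - {v}. w v u) = (\<Sum>u | u \<in> W - {v} \<and> f u = f v. w v u) + (\<Sum>u | u \<in> W - {v} \<and> f u \<noteq> f v. w v u)"
      using finW by (subst sum.union_disjoint[symmetric]) (auto intro!: sum.cong)
    moreover have "(\<Sum>u | u \<in> W - {v} \<and> f u \<noteq> f v. w v u) = card {u \<in> W. (v, u) \<in> E \<and> (v \<in> B \<longleftrightarrow> u \<notin> B)}"
    proof -
      have "{u \<in> W. (v, u) \<in> E \<and> (v \<in> B \<longleftrightarrow> u \<notin> B)} = {u \<in> {u. u \<in> W - {v} \<and> f u \<noteq> f v}. (v, u) \<in> E}"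
        using side v by auto
      then show ?thesis using finW by (simp add: w_def of_bool_def sum.If_cases Int_def)
    qed
    ultimately show "t \<le> 4 * card {u \<in> W. (v, u) \<in> E \<and> (v \<in> B \<longleftrightarrow> u \<notin> B)}"
      using W(3)[OF v] f(2)[OF v] by simp
  qed
qed

text \<open>
  With degrees capped at \<open>K\<close> times the square root of \<open>card V\<close>, at most half of the arcs
  are lost; the remaining ones give minimum degree \<open>c / 16\<close> times that root in the
  bipartite subgraph, half of which is kept as \<open>\<delta>\<close> to absorb the \<open>+ 1\<close> in the
  degree condition.  The summand \<open>1\<close> of \<open>K\<close> only ensures that the cap is at least
  \<open>1\<close>.
\<close>
lemma dense_c4_free_has_linkage:
  fixes E :: "'a rel" and c K :: real and r :: nat
  assumes fin: "finite V" and E: "E \<subseteq> V \<times> V" "sym E" "irrefl E"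
    and c4: "\<And>u v a b. (u, a) \<in> E \<Longrightarrow> (a, v) \<in> E \<Longrightarrow> (u, b) \<in> E \<Longrightarrow> (b, v) \<in> E \<Longrightarrow> u \<noteq> v \<Longrightarrow> a = b"
    and "c > 0" and dense: "card E \<ge> c * (card V * sqrt (card V))"
    and large: "c / 32 * sqrt (card V) \<ge> 1"
    and K: "K = 8 / c + 1" and r: "8 * K\<^sup>2 \<le> r * (c / 32) ^ 4"
  obtains U mid con where "U \<subseteq> V" "linkage E U mid con" "(c / 32) ^ 5 * sqrt (card V) \<le> 4 * r * card U"
proof -
  define n where "n = card V"
  define s where "s = sqrt n"
  have "s > 0" using large \<open>c > 0\<close> by (cases "V = {}") (auto simp: s_def n_def fin card_gt_0_iff)
  then have "n \<ge> 1" by (cases n) (auto simp: s_def)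
  then have "s \<ge> 1" by (simp add: s_def)
  have s2: "s\<^sup>2 = n" by (simp add: s_def)
  have "K > 1" using \<open>c > 0\<close> by (simp add: K)
  have "1 * 1 \<le> K * s" using \<open>s \<ge> 1\<close> \<open>K > 1\<close> by (intro mult_mono) auto
  define V1 where "V1 = {v \<in> V. card (E `` {v}) \<le> K * s}"
  have V1: "V1 \<subseteq> V" by (auto simp: V1_def)
  have finV1: "finite V1" using V1 fin by (rule finite_subset)
  have nV1: "card V1 \<le> n" unfolding n_def using fin V1 by (rule card_mono)
  have "card E \<le> card (E \<inter> V1 \<times> V1) + 4 * (card V)\<^sup>2 / (K * s)"
    using \<open>1 * 1 \<le> K * s\<close> by (intro few_arcs_at_high_degree[OF fin E(1,2) _ c4 V1_def]) auto
  moreover have "4 * (card V)\<^sup>2 / (K * s) \<le> c / 2 * (n * s)"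
  proof -
    have "4 * (card V)\<^sup>2 / (K * s) = 4 / K * (n * (s\<^sup>2 / s))"
      unfolding s2 by (simp add: n_def power2_eq_square)
    then have "4 * (card V)\<^sup>2 / (K * s) = 4 / K * (n * s)" by (simp add: power2_eq_square)
    moreover have "4 / K \<le> c / 2" using \<open>c > 0\<close> by (simp add: K field_simps)
    ultimately show ?thesis using \<open>s > 0\<close> by (simp only:) (intro mult_right_mono, auto)
  qed
  moreover have "card E \<ge> c * (n * s)" using dense by (simp add: n_def s_def)
  ultimately have "card (E \<inter> V1 \<times> V1) \<ge> c / 2 * (n * s)" by simp
  moreover have "c / 4 * s * card V1 \<le> c / 4 * s * n"
    using nV1 \<open>c > 0\<close> \<open>s > 0\<close> by (intro mult_left_mono) auto
  moreover have "c / 4 * s * n < c / 2 * (n * s)"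
    using \<open>c > 0\<close> \<open>s > 0\<close> \<open>n \<ge> 1\<close> by (simp add: field_simps)
  ultimately have many: "card (E \<inter> V1 \<times> V1) > c / 4 * s * card V1" by linarith
  obtain W B where W: "W \<subseteq> V1" "W \<noteq> {}"
    "\<And>v. v \<in> W \<Longrightarrow> c / 4 * s \<le> 4 * card {u \<in> W. (v, u) \<in> E \<and> (v \<in> B \<longleftrightarrow> u \<notin> B)}"
    by (rule bipartite_min_degree_subgraph[OF finV1 E(2,3) many]) (rule that)
  define F where "F = {(u, v). u \<in> W \<and> v \<in> W \<and> (u, v) \<in> E \<and> (u \<in> B \<longleftrightarrow> v \<notin> B)}"
  have "F \<subseteq> E" by (auto simp: F_def)
  obtain x where x: "x \<in> W" using W(2) by blast
  define \<Delta> where "\<Delta> = nat \<lfloor>K * s\<rfloor>"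
  have \<Delta>: "real \<Delta> \<le> K * s" using \<open>1 * 1 \<le> K * s\<close> by (simp add: \<Delta>_def)
  have finE: "finite (E `` {v})" for v using E(1) fin by (auto intro: finite_subset[of _ V])
  have finW: "finite W" using W(1) finV1 by (rule finite_subset)
  interpret c4free_bipartite W F B \<Delta> x
  proof
    show "finite W" by (rule finW)
    show "F \<subseteq> W \<times> W" by (auto simp: F_def)
    show "sym F" using E(2) by (auto simp: F_def sym_def)
    show "u \<in> B \<longleftrightarrow> v \<notin> B" if "(u, v) \<in> F" for u v using that by (simp add: F_def)
    show "a = b" if "(u, a) \<in> F" "(a, v) \<in> F" "(u, b) \<in> F" "(b, v) \<in> F" "u \<noteq> v" for u v a b
      using c4[of u a v b] that \<open>F \<subseteq> E\<close> by blast
    show "card (F `` {v}) \<le> \<Delta>" if "v \<in> W" for v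
    proof -
      have "card (F `` {v}) \<le> card (E `` {v})" using finE \<open>F \<subseteq> E\<close> by (intro card_mono) auto
      moreover have "card (E `` {v}) \<le> K * s" using that W(1) by (auto simp: V1_def)
      ultimately show ?thesis unfolding \<Delta>_def by (simp add: le_nat_iff le_floor_iff)
    qed
  qed
  define \<delta> where "\<delta> = c / 32 * s"
  have "\<delta> \<ge> 1" using large by (simp add: \<delta>_def s_def n_def)
  have deg: "\<delta> + 1 \<le> card (F `` {v})" if "v \<in> W" for v
  proof -
    have "F `` {v} = {u \<in> W. (v, u) \<in> E \<and> (v \<in> B \<longleftrightarrow> u \<notin> B)}" using that by (auto simp: F_def)
    then have "2 * \<delta> \<le> card (F `` {v})" using W(3)[OF that] by (simp add: \<delta>_def)
    then show ?thesis using \<open>\<delta> \<ge> 1\<close> by simp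
  qed
  have nW: "card W \<le> n" using card_mono[OF finV1 W(1)] nV1 by simp
  have s4: "s ^ 4 = (real n)\<^sup>2" unfolding s2[symmetric] by (simp add: power_mult[symmetric])
  have "8 * \<Delta>\<^sup>2 * card W \<le> r * \<delta> ^ 4"
  proof -
    have "8 * (real \<Delta>)\<^sup>2 * card W \<le> 8 * (K * s)\<^sup>2 * n"
      using \<Delta> nW by (intro mult_mono power_mono) auto
    also have "\<dots> = 8 * K\<^sup>2 * (real n)\<^sup>2"
      unfolding power_mult_distrib s2 by (simp add: power2_eq_square)
    also have "\<dots> \<le> r * (c / 32) ^ 4 * (real n)\<^sup>2" using r by (intro mult_right_mono) auto
    also have "\<dots> = r * \<delta> ^ 4" by (simp only: \<delta>_def power_mult_distrib s4 mult_ac)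
    finally show ?thesis by simp
  qed
  moreover have "r > 0" using r \<open>K > 1\<close> by (cases r) auto
  ultimately obtain U mid con where U: "U \<subseteq> W" "linkage F U mid con" "\<delta> ^ 5 \<le> 4 * r * (card W)\<^sup>2 * card U"
    using large_linkage[OF x _ _ deg, where r = r] \<open>\<delta> \<ge> 1\<close> by auto
  show ?thesis
  proof
    show "U \<subseteq> V" using U(1) W(1) V1 by blast
    show "linkage E U mid con" using U(2) \<open>F \<subseteq> E\<close> unfolding linkage_def by blast
    have "(real n)\<^sup>2 * ((c / 32) ^ 5 * s) = \<delta> ^ 5"
      unfolding \<delta>_def power_mult_distrib s4[symmetric] by (simp add: eval_nat_numeral)
    also have "\<dots> \<le> 4 * r * (card W)\<^sup>2 * card U" by (rule U(3))
    also have "\<dots> \<le> 4 * r * n\<^sup>2 * card U" using nW by (intro of_nat_mono mult_le_mono power_mono) auto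
    also have "\<dots> = (real n)\<^sup>2 * (4 * r * card U)" by simp
    finally show "(c / 32) ^ 5 * sqrt (card V) \<le> 4 * r * card U"
      using \<open>n \<ge> 1\<close> by (simp add: s_def n_def)
  qed
qed

section \<open>Subdivided cliques in dense graphs without 4-cycles\<close>

theorem theorem1p4:
  shows "\<forall>c::real. c > 0 \<longrightarrow>
    (\<exists>c'::real. c' > 0 \<and>
      (\<forall>(G :: 'a pair_pre_digraph) n.
         pair_graph G \<and> card (pverts G) = n \<and> C4_free G
         \<and> real (card (uedges G)) \<ge> c * real n powr (3/2)
         \<longrightarrow> contains_exact_TK 3 (nat \<lfloor>c' * real n powr (1/2)\<rfloor>) G))"
proof (intro allI impI)
  fix c :: real
  assume "c > 0"
  define K where "K = 8 / c + 1"
  define r where "r = nat \<lceil>8 * K\<^sup>2 / (c / 32) ^ 4\<rceil>"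
  have "K > 0" using \<open>c > 0\<close> by (simp add: K_def add_pos_pos)
  have "8 * K\<^sup>2 / (c / 32) ^ 4 \<le> r" unfolding r_def by linarith
  then have r: "8 * K\<^sup>2 \<le> r * (c / 32) ^ 4" using \<open>c > 0\<close> by (simp add: divide_le_eq)
  then have "r > 0" using \<open>K > 0\<close> by (cases r) auto
  \<comment> \<open>The first term makes the number of branch vertices 0 whenever \<open>n\<close> is too small for
    the density argument.\<close>
  define c' where "c' = min (c / 64) ((c / 32) ^ 5 / (4 * r))"
  have "c' > 0" using \<open>c > 0\<close> \<open>r > 0\<close> by (simp add: c'_def)
  moreover have "contains_exact_TK 3 (nat \<lfloor>c' * real n powr (1/2)\<rfloor>) G"
    if "pair_graph G \<and> card (pverts G) = n \<and> C4_free G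
        \<and> real (card (uedges G)) \<ge> c * real n powr (3/2)"
    for G :: "'a pair_pre_digraph" and n
  proof -
    have G: "pair_graph G" "card (pverts G) = n" "C4_free G"
      "real (card (uedges G)) \<ge> c * real n powr (3/2)" using that by auto
    interpret G: pair_graph G by fact
    have root: "real n powr (1/2) = sqrt n" by (simp add: powr_half_sqrt)
    obtain U mid con where U: "U \<subseteq> pverts G" "linkage (parcs G) U mid con"
      "nat \<lfloor>c' * sqrt n\<rfloor> \<le> card U"
    \<comment> \<open>For \<open>n\<close> below the threshold the subdivision asked for is empty.\<close>
    proof (cases "c / 32 * sqrt n \<ge> 1")
      case False
      have "c' * sqrt n \<le> c / 32 * sqrt n" using \<open>c > 0\<close> by (intro mult_right_mono) (auto simp: c'_def)
      then have "nat \<lfloor>c' * sqrt n\<rfloor> = 0" using False by linarith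
      then show ?thesis using that[of "{}"] by (simp add: linkage_def)
    next
      case True
      have "uedges G = (\<lambda>(u, v). {u, v}) ` parcs G" by (auto simp: uedges_def)
      then have "card (uedges G) \<le> card (parcs G)" using G.pair_finite_arcs by (simp add: card_image_le)
      moreover have "real n powr (3/2) = n * sqrt n"
      proof -
        have "real n powr (3/2) = real n powr (1 + 1/2)" by simp
        also have "\<dots> = n * sqrt n" unfolding powr_add root by simp
        finally show ?thesis .
      qed
      ultimately have dense: "card (parcs G) \<ge> c * (card (pverts G) * sqrt (card (pverts G)))"
        using G(2,4) by simp
      have E: "parcs G \<subseteq> pverts G \<times> pverts G" "sym (parcs G)" "irrefl (parcs G)"
        using G.wellformed' G.arcs_symmetric G.no_loops'[of v v for v] by (auto simp: sym_def irrefl_def)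
      obtain U mid con where U: "U \<subseteq> pverts G" "linkage (parcs G) U mid con"
        "(c / 32) ^ 5 * sqrt (card (pverts G)) \<le> 4 * r * card U"
        by (rule dense_c4_free_has_linkage[OF G.pair_finite_verts E
              C4_free_common_neighbour_unique[OF G(1,3)] \<open>c > 0\<close> dense _ K_def r])
          (use True G(2) in \<open>auto intro: that\<close>)
      have "c' * sqrt n \<le> (c / 32) ^ 5 / (4 * r) * sqrt n"
        by (intro mult_right_mono) (auto simp: c'_def)
      also have "\<dots> \<le> card U" using U(3) G(2) \<open>r > 0\<close> by (simp add: divide_le_eq mult_ac)
      finally have "nat \<lfloor>c' * sqrt n\<rfloor> \<le> card U" by linarith
      then show ?thesis using that U(1,2) by blast
    qed
    have "finite U" using U(1) G.pair_finite_verts by (rule finite_subset)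
    then show ?thesis unfolding root using linkage_imp_exact_TK[OF G(1) U(2,1) _ U(3)] by blast
  qed
  ultimately show "\<exists>c'::real. c' > 0 \<and>
      (\<forall>(G :: 'a pair_pre_digraph) n.
         pair_graph G \<and> card (pverts G) = n \<and> C4_free G
         \<and> real (card (uedges G)) \<ge> c * real n powr (3/2)
         \<longrightarrow> contains_exact_TK 3 (nat \<lfloor>c' * real n powr (1/2)\<rfloor>) G)"
    by blast
qed

end
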